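(* Let $\lambda$ be a nonzero real number, let $r,k\in\mathbb{N}=\{1,2,3,\dots\}$, and let $n\ge 0$ be an integer. Then $$\binom{n+k}{k}H_{n+k,\lambda}^{(r)}=\binom{n+r+k-1}{n}H_{k}^{(r)}+\binom{r+k-1}{k}H_{n,\lambda}^{(k+r)}+\lambda\left\{\binom{n+r+k-1}{n}\binom{r+k-1}{k}\sum_{l=2}^{k}\frac{q_{l-1}(\lambda)}{r+l-1}+\binom{r+k-1}{k}q_{k}(\lambda)H_{n,\lambda}^{(k+r)}\right\},$$ where, for each $j\in\mathbb{N}$, $q_{j}(\lambda)$ (which depends on $r$) is the polynomial in $\lambda$ of degree $j-1$ given by $$q_{j}(\lambda)=\frac{1}{\lambda}\left(\frac{(-1)^{j}}{\binom{j+r-1}{j}}\binom{\lambda-r}{j}-1\right).$$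
   Context: For real $x$ and an integer $m\ge 0$, $\binom{x}{m}=\frac{x(x-1)\cdots(x-m+1)}{m!}$ is the generalized binomial coefficient (with $\binom{x}{0}=1$). Empty sums are $0$. The harmonic numbers are $H_0=0$, $H_n=1+\frac12+\cdots+\frac1n$ for $n\ge 1$. The hyperharmonic numbers $H_n^{(r)}$ ($n\ge0$, $r\ge 1$) are defined by $H_0^{(r)}=0$, $H_n^{(1)}=H_n$, and $H_n^{(r)}=\sum_{j=1}^{n}H_j^{(r-1)}$ for $r\ge 2$. For nonzero real $\lambda$, the degenerate harmonic numbers are defined by $H_{0,\lambda}=0$ and $H_{n,\lambda}=\sum_{j=1}^{n}\frac{1}{\lambda}\binom{\lambda}{j}(-1)^{j-1}$ for $n\ge 1$. The degenerate hyperharmonic numbers $H_{n,\lambda}^{(r)}$ ($n\ge 0$, $r\ge 1$) are defined by $H_{0,\lambda}^{(r)}=0$, $H_{n,\lambda}^{(1)}=H_{n,\lambda}$, and $H_{n,\lambda}^{(r)}=\sum_{j=1}^{n}H_{j,\lambda}^{(r-1)}$ for $r\ge 2$. For fixed $r\in\mathbb{N}$, the polynomials $q_j$ are equivalently defined by $\prod_{i=0}^{j-1}\left(1-\frac{\lambda}{r+i}\right)=1+\lambda q_j(\lambda)$. *)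

theory Defs
  imports "HOL-Analysis.Harmonic_Numbers" "HOL-Computational_Algebra.Polynomial"
begin

text \<open>The order \<open>r\<close> ranges over \<open>r \<ge> 1\<close>; order \<open>0\<close> is given the dummy value \<open>0\<close>.
  The initial values at \<open>n = 0\<close> are those of empty sums.\<close>

fun hyperharm :: "nat \<Rightarrow> nat \<Rightarrow> real" where
  "hyperharm 0 n = 0"
| "hyperharm (Suc 0) n = harm n"
| "hyperharm (Suc (Suc r)) n = (\<Sum>j=1..n. hyperharm (Suc r) j)"

definition deg_harm :: "real \<Rightarrow> nat \<Rightarrow> real" where
  "deg_harm lam n = (\<Sum>j=1..n. 1 / lam * (lam gchoose j) * (-1) ^ (j - 1))"

fun deg_hyperharm :: "real \<Rightarrow> nat \<Rightarrow> nat \<Rightarrow> real" where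
  "deg_hyperharm lam 0 n = 0"
| "deg_hyperharm lam (Suc 0) n = deg_harm lam n"
| "deg_hyperharm lam (Suc (Suc r)) n = (\<Sum>j=1..n. deg_hyperharm lam (Suc r) j)"

text \<open>\<open>qfun r j lam\<close> is meaningful for \<open>r, j \<ge> 1\<close> and \<open>lam \<noteq> 0\<close>; that it is polynomial
  in \<open>lam\<close> is not built into the definition.\<close>

definition qfun :: "nat \<Rightarrow> nat \<Rightarrow> real \<Rightarrow> real" where
  "qfun r j lam =
     1 / lam * ((-1) ^ j / real ((j + r - 1) choose j) * ((lam - real r) gchoose j) - 1)"

end

theory Submission
  imports Defs
begin

text \<open>
  Write \<open>P\<^sub>j = \<Prod>i<j. (1 - \<lambda> / (r + i)) = 1 + \<lambda> q\<^sub>j\<close>, a quotient of Pochhammer symbols. By iterated summation,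
  \<open>H\<^sub>n\<^sub>,\<^sub>\<lambda>\<close> of order \<open>r\<close> equals \<open>binom (n + r - 1) n * (1 - P\<^sub>n) / \<lambda>\<close>, and \<open>H\<^sub>k\<close> of order \<open>r\<close> equals
  \<open>binom (r + k - 1) k * (\<Sum>l<k. 1 / (r + l))\<close>. The common factor
  \<open>binom (n + r + k - 1) n * binom (r + k - 1) k\<close> can then be cancelled, and what remains is the telescoping sum
  \<open>(\<Sum>l<k. P\<^sub>l / (r + l)) = (1 - P\<^sub>k) / \<lambda>\<close> together with the multiplicativity of Pochhammer symbols.
\<close>

text \<open>Hockey-stick identity: \<open>pochhammer a j / fact j\<close> is the binomial
  coefficient of \<open>a + j - 1\<close> over \<open>j\<close>, so each summation shifts
  \<open>a\<close> by one. The \<open>- 1\<close> accounts for the missing term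
  \<open>j = 0\<close>.\<close>

lemma sum_pochhammer_fact:
  fixes a :: real
  shows "(\<Sum>j=1..n. pochhammer a j / fact j) = pochhammer (a + 1) n / fact n - 1"
proof (induction n)
  case (Suc n)
  have "pochhammer (a + 1) n / fact n + a * pochhammer (a + 1) n / fact (Suc n)
      = pochhammer (a + 1) n * (a + 1 + real n) / fact (Suc n)"
    by (simp add: divide_simps) (simp add: algebra_simps)
  then show ?case
    using Suc by (simp add: pochhammer_rec[of a] pochhammer_Suc[of "a + 1"])
qed simp

text \<open>This is the hockey-stick identity differentiated in \<open>a\<close>: the logarithmic
  derivative of \<open>pochhammer a j\<close> is the sum of the \<open>1 / (a + l)\<close>.\<close>

lemma sum_pochhammer_fact_harmonic:
  fixes a :: real
  assumes "a > 0"
  shows "(\<Sum>j=1..n. pochhammer a j / fact j * (\<Sum>l<j. 1 / (a + real l)))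
    = pochhammer (a + 1) n / fact n * (\<Sum>l<n. 1 / (a + 1 + real l))"
proof (induction n)
  case (Suc n)
  define p where "p = pochhammer (a + 1) n"
  define S where "S = (\<Sum>l<n. 1 / (a + 1 + real l))"
  have shift: "(\<Sum>l<Suc n. 1 / (a + real l)) = 1 / a + S"
    by (simp add: sum.lessThan_Suc_shift S_def add_ac del: sum.lessThan_Suc)
  have "a + 1 + real n \<noteq> 0"
    using assms by linarith
  then have "p / fact n * S + a * p / fact (Suc n) * (1 / a + S)
      = p * (a + 1 + real n) / fact (Suc n) * (S + 1 / (a + 1 + real n))"
    using assms by (simp add: divide_simps) (simp add: algebra_simps)
  then show ?case
    using Suc shift
    by (simp add: pochhammer_rec[of a] pochhammer_Suc[of "a + 1"] p_def S_def
        del: sum.lessThan_Suc fact_Suc) (simp add: mult_ac)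
qed simp

lemma hyperharm_eq:
  "hyperharm (Suc r) k
    = pochhammer (real (Suc r)) k / fact k * (\<Sum>l<k. 1 / (real (Suc r) + real l))"
proof (induction r arbitrary: k)
  case 0
  have "(\<Sum>l<k. 1 / (1 + real l)) = harm k"
    by (simp add: harm_def sum.atLeast1_atMost_eq inverse_eq_divide)
  then show ?case
    by (simp add: pochhammer_fact[symmetric])
next
  case (Suc r)
  then show ?case
    using sum_pochhammer_fact_harmonic[of "real (Suc r)" k] by (simp add: add_ac)
qed

text \<open>Raising the order applies the hockey-stick identity to both Pochhammer terms; their
  \<open>- 1\<close> corrections cancel in the difference.\<close>

lemma deg_hyperharm_eq:
  "deg_hyperharm lam (Suc r) n
    = (pochhammer (real (Suc r)) n - pochhammer (real (Suc r) - lam) n) / (fact n * lam)"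
proof (induction r arbitrary: n)
  case 0
  \<comment> \<open>The Pochhammer form of the binomial contributes \<open>(-1) ^ j\<close>; as
    \<open>j\<close> is positive, the total sign is always \<open>-1\<close>.\<close>
  have "1 / lam * (lam gchoose j) * (-1) ^ (j - 1) = - (1 / lam) * (pochhammer (- lam) j / fact j)"
    if "j \<in> {1..n}" for j
    using that by (cases j) (auto simp: gbinomial_pochhammer simp flip: power_mult_distrib)
  then have "deg_harm lam n = - (1 / lam) * (\<Sum>j=1..n. pochhammer (- lam) j / fact j)"
    unfolding deg_harm_def sum_distrib_left by (intro sum.cong) auto
  also have "\<dots> = (fact n - pochhammer (1 - lam) n) / (fact n * lam)"
    unfolding sum_pochhammer_fact by (cases "lam = 0") (simp_all add: field_simps)
  finally show ?case
    by (simp add: pochhammer_fact[symmetric])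
next
  case (Suc r)
  have "deg_hyperharm lam (Suc (Suc r)) n
      = (\<Sum>j=1..n. pochhammer (real (Suc r)) j / fact j) / lam
        - (\<Sum>j=1..n. pochhammer (real (Suc r) - lam) j / fact j) / lam"
    unfolding deg_hyperharm.simps(3) Suc sum_divide_distrib sum_subtractf[symmetric]
    by (simp add: diff_divide_distrib)
  also have "\<dots> = (pochhammer (real (Suc r) + 1) n / fact n
        - pochhammer (real (Suc r) - lam + 1) n / fact n) / lam"
    unfolding sum_pochhammer_fact by (simp add: diff_divide_distrib)
  finally show ?case
    by (simp add: algebra_simps diff_divide_distrib)
qed

lemma binomial_eq_pochhammer:
  assumes "r \<ge> 1"
  shows "real ((j + r - 1) choose j) = pochhammer (real r) j / fact j"
  using assms
  by (simp add: binomial_gbinomial gbinomial_pochhammer' of_nat_diff)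

text \<open>The sign \<open>(-1) ^ j\<close> turns the falling factorial of \<open>lam - r\<close>
  into the rising factorial of \<open>r - lam\<close>.\<close>

lemma qfun_eq:
  assumes "r \<ge> 1"
  shows "qfun r j lam = (pochhammer (real r - lam) j / pochhammer (real r) j - 1) / lam"
  unfolding qfun_def binomial_eq_pochhammer[OF assms]
  by (simp add: gbinomial_pochhammer flip: power_mult_distrib)

text \<open>Passing from \<open>l\<close> to \<open>l + 1\<close> multiplies the ratio by
  \<open>1 - lam / (a + l)\<close>, so the summand times \<open>lam\<close> is the drop of the
  ratio.\<close>

lemma sum_pochhammer_ratio:
  fixes a lam :: real
  assumes "a > 0"
  shows "lam * (\<Sum>l<k. pochhammer (a - lam) l / pochhammer a l / (a + real l))
    = 1 - pochhammer (a - lam) k / pochhammer a k"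
proof (induction k)
  case (Suc k)
  define u v w where "u = pochhammer (a - lam) k" and "v = pochhammer a k" and "w = a + real k"
  have "v > 0" "w > 0"
    using assms by (auto simp: v_def w_def intro: pochhammer_pos)
  then have "1 - u / v + lam * (u / v / w) = 1 - u * (w - lam) / (v * w)"
    by (simp add: field_simps)
  then show ?case
    using Suc by (simp add: pochhammer_Suc distrib_left u_def v_def w_def algebra_simps)
qed simp

lemma qfun_polynomial:
  assumes "r \<ge> 1" and "j \<ge> 1"
  shows "\<exists>p :: real poly. degree p = j - 1 \<and> (\<forall>\<mu>. \<mu> \<noteq> 0 \<longrightarrow> poly p \<mu> = qfun r j \<mu>)"
proof -
  define F where "F = (\<Prod>i<j. [:1, - 1 / (real r + real i):])"
  have ne: "real r + real i \<noteq> 0" for i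
    using assms by linarith
  have "degree F = (\<Sum>i<j. degree [:1, - 1 / (real r + real i):])"
    unfolding F_def by (rule degree_prod_eq_sum_degree) auto
  also have "\<dots> = j"
    using ne by simp
  finally have degF: "degree F = j" .
  have polyF: "poly F \<mu> = pochhammer (real r - \<mu>) j / pochhammer (real r) j" for \<mu>
    unfolding F_def poly_prod pochhammer_prod prod_dividef[symmetric] atLeast0LessThan
    using ne by (intro prod.cong) (auto simp: field_simps)
  obtain c q where F: "F = pCons c q"
    by (cases F)
  have "poly F 0 = 1"
    by (simp add: F_def poly_prod)
  then have c: "c = 1"
    by (simp add: F)
  have "degree q = j - 1"
    using degF assms by (cases "q = 0") (auto simp: F)
  moreover have "poly q \<mu> = qfun r j \<mu>" if "\<mu> \<noteq> 0" for \<mu>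
    using polyF[of \<mu>] that by (simp add: F c qfun_eq[OF assms(1)] field_simps)
  ultimately show ?thesis
    by blast
qed

theorem theorem2:
  fixes lam :: real and r k n :: nat
  assumes "lam \<noteq> 0" and "r \<ge> 1" and "k \<ge> 1"
  shows "(\<forall>j\<ge>1. \<exists>p :: real poly. degree p = j - 1 \<and>
            (\<forall>\<mu>. \<mu> \<noteq> 0 \<longrightarrow> poly p \<mu> = qfun r j \<mu>)) \<and>
    real ((n + k) choose k) * deg_hyperharm lam r (n + k) =
      real ((n + r + k - 1) choose n) * hyperharm r k
      + real ((r + k - 1) choose k) * deg_hyperharm lam (k + r) n
      + lam * (real ((n + r + k - 1) choose n) * real ((r + k - 1) choose k)
               * (\<Sum>l=2..k. qfun r (l - 1) lam / real (r + l - 1))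
             + real ((r + k - 1) choose k) * qfun r k lam * deg_hyperharm lam (k + r) n)"
proof (intro conjI allI impI)
  fix j :: nat
  assume "j \<ge> 1"
  then show "\<exists>p :: real poly. degree p = j - 1 \<and> (\<forall>\<mu>. \<mu> \<noteq> 0 \<longrightarrow> poly p \<mu> = qfun r j \<mu>)"
    using qfun_polynomial \<open>r \<ge> 1\<close> by blast
next
  have r: "real r > 0" "real r + real k > 0"
    using \<open>r \<ge> 1\<close> by auto
  define A where "A = pochhammer (real r) k"
  define B where "B = pochhammer (real r + real k) n"
  define C where "C = pochhammer (real r - lam) k"
  define D where "D = pochhammer (real r + real k - lam) n"
  have pos: "A > 0" "B > 0"
    using r by (auto simp: A_def B_def intro: pochhammer_pos)
  \<comment> \<open>A Pochhammer symbol of length \<open>n + k\<close> splits after its first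
    \<open>k\<close> factors, giving \<open>A * B\<close> and \<open>C * D\<close>.\<close>
  have H: "deg_hyperharm lam r (n + k) = (A * B - C * D) / (fact (n + k) * lam)"
    using deg_hyperharm_eq[of lam "r - 1" "n + k"] \<open>r \<ge> 1\<close>
      pochhammer_product'[of "real r" k n] pochhammer_product'[of "real r - lam" k n]
    by (simp add: A_def B_def C_def D_def algebra_simps)
  have Hk: "deg_hyperharm lam (k + r) n = (B - D) / (fact n * lam)"
    using deg_hyperharm_eq[of lam "k + r - 1" n] \<open>r \<ge> 1\<close>
    by (simp add: B_def D_def algebra_simps)
  have hk: "hyperharm r k = A / fact k * (\<Sum>l<k. 1 / (real r + real l))"
    using hyperharm_eq[of "r - 1" k] \<open>r \<ge> 1\<close> by (simp add: A_def)
  have bin: "real ((n + k) choose k) = fact (n + k) / (fact k * fact n)"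
    by (simp add: binomial_fact)
  have binA: "real ((r + k - 1) choose k) = A / fact k"
    using binomial_eq_pochhammer[OF \<open>r \<ge> 1\<close>, of k] by (simp add: A_def add.commute)
  have binB: "real ((n + r + k - 1) choose n) = B / fact n"
    using binomial_eq_pochhammer[of "r + k" n] \<open>r \<ge> 1\<close> by (simp add: B_def add_ac)
  have q: "lam * qfun r k lam = C / A - 1"
    using \<open>lam \<noteq> 0\<close> by (simp add: qfun_eq[OF \<open>r \<ge> 1\<close>] A_def C_def)
  \<comment> \<open>The summand for \<open>l = 0\<close> vanishes because \<open>q\<^sub>0 = 0\<close>.\<close>
  have "(\<Sum>l=2..k. qfun r (l - 1) lam / real (r + l - 1))
      = (\<Sum>l<k. qfun r l lam / (real r + real l))"
  proof -
    obtain m where "k = Suc m"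
      using \<open>k \<ge> 1\<close> by (cases k) auto
    moreover have "(\<Sum>l=2..Suc m. qfun r (l - 1) lam / real (r + l - 1))
        = (\<Sum>l<m. qfun r (Suc l) lam / (real r + real (Suc l)))"
      by (rule sum.reindex_bij_witness[of _ "\<lambda>l. l + 2" "\<lambda>l. l - 2"])
        (auto simp: of_nat_diff Suc_diff_Suc numeral_2_eq_2)
    moreover have "qfun r 0 lam = 0"
      by (simp add: qfun_def)
    ultimately show ?thesis
      by (simp add: sum.lessThan_Suc_shift del: sum.lessThan_Suc)
  qed
  \<comment> \<open>Since \<open>1 + lam * qfun r l lam\<close> is the Pochhammer ratio, the
    harmonic sum and the \<open>qfun\<close> sum merge into the telescoping one.\<close>
  then have "(\<Sum>l<k. 1 / (real r + real l))
        + lam * (\<Sum>l=2..k. qfun r (l - 1) lam / real (r + l - 1))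
      = (\<Sum>l<k. (1 + lam * qfun r l lam) / (real r + real l))"
    by (simp add: sum_distrib_left sum.distrib add_divide_distrib)
  also have "\<dots> = (\<Sum>l<k. pochhammer (real r - lam) l / pochhammer (real r) l / (real r + real l))"
    using \<open>lam \<noteq> 0\<close> by (simp add: qfun_eq[OF \<open>r \<ge> 1\<close>])
  also have "\<dots> = (1 - C / A) / lam"
    using sum_pochhammer_ratio[OF r(1), of lam k] \<open>lam \<noteq> 0\<close>
    by (simp add: A_def C_def field_simps)
  finally have sums: "(\<Sum>l<k. 1 / (real r + real l))
        + lam * (\<Sum>l=2..k. qfun r (l - 1) lam / real (r + l - 1)) = (1 - C / A) / lam" .
  let ?S = "\<Sum>l<k. 1 / (real r + real l)"
  let ?Q = "\<Sum>l=2..k. qfun r (l - 1) lam / real (r + l - 1)"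
  have "B / fact n * (A / fact k * ?S) + A / fact k * ((B - D) / (fact n * lam))
        + lam * (B / fact n * (A / fact k) * ?Q
          + A / fact k * qfun r k lam * ((B - D) / (fact n * lam)))
      = A * B / (fact n * fact k) * (?S + lam * ?Q)
        + A / fact k * (1 + lam * qfun r k lam) * ((B - D) / (fact n * lam))"
    by (simp add: distrib_left distrib_right mult_ac)
  \<comment> \<open>The first product yields \<open>A * B - B * C\<close> and the second
    \<open>B * C - C * D\<close>, so the mixed term cancels.\<close>
  also have "\<dots> = (A * B - C * D) / (fact n * fact k * lam)"
    unfolding sums q using pos \<open>lam \<noteq> 0\<close> by (simp add: field_simps)
  also have "\<dots> = fact (n + k) / (fact k * fact n) * ((A * B - C * D) / (fact (n + k) * lam))"
    by (simp add: mult_ac)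
  finally show "real ((n + k) choose k) * deg_hyperharm lam r (n + k) =
      real ((n + r + k - 1) choose n) * hyperharm r k
      + real ((r + k - 1) choose k) * deg_hyperharm lam (k + r) n
      + lam * (real ((n + r + k - 1) choose n) * real ((r + k - 1) choose k)
               * (\<Sum>l=2..k. qfun r (l - 1) lam / real (r + l - 1))
             + real ((r + k - 1) choose k) * qfun r k lam * deg_hyperharm lam (k + r) n)"
    unfolding H Hk hk bin binA binB by (rule sym)
qed

end
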